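(* Let $K,L,k$ be non-negative integers such that $2K-L\le2k\le2K$, suppose $L$ is even, and let $\alpha_1,\alpha_2>0$. Let $\gamma$ be a closed contour going around $0$ once in the positive direction. Let $P_k$ be the unique monic $2\times2$ matrix-valued polynomial of degree $k$ with $$\frac{1}{2\pi i}\oint_\gamma P_k(z)\frac{(W_{\alpha_1}(z)W_{\alpha_2}(z))^{L/2}}{z^K}z^j\,dz=0_2,\quad j=0,\ldots,k-1,\qquad W_\alpha(z)=\begin{pmatrix}\alpha & 1 \\ z & 1\end{pmatrix}.$$ Let $$\beta=\frac{1-\alpha_1\alpha_2}{2\sqrt{1+\alpha_1}\sqrt{1+\alpha_2}},\qquad \eta_j=-\frac{1+2\alpha_j+\alpha_1\alpha_2}{2\sqrt{1+\alpha_1}\sqrt{1+\alpha_2}},\quad j=1,2.$$ (a) Then $$\begin{pmatrix}\sqrt{\frac{1+\alpha_2}{1+\alpha_1}} & 0 \\ 0 & 1\end{pmatrix}P_k(\zeta^2-\beta^2)\begin{pmatrix}\sqrt{\frac{1+\alpha_1}{1+\alpha_2}} & \sqrt{\frac{1+\alpha_1}{1+\alpha_2}} \\ \zeta+\beta & -\zeta+\beta\end{pmatrix}=\begin{pmatrix}q_{2k}(\zeta) & q_{2k}(-\zeta) \\ q_{2k+1}(\zeta) & q_{2k+1}(-\zeta)\end{pmatrix},$$ where $q_{2k}$ and $q_{2k+1}$ are monic polynomials of degrees $2k$ and $2k+1$ respectively, satisfying $$\frac{1}{2\pi i}\oint_{\gamma_R}q_{2k+\epsilon}(\zeta)\,\zeta^j\,\frac{\left((\zeta-\eta_1)(\zeta-\eta_2)\right)^{L/2}}{(\zeta^2-\beta^2)^K}\,d\zeta=0,\qquad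 j=0,1,\ldots,2k-1,\quad\epsilon=0,1,\qquad(\ast)$$ where $\gamma_R$ is the positively oriented circle of radius $R>|\beta|$ around $0$. (b) Conversely, if $q_{2k}$ and $q_{2k+1}$ are monic polynomials of degrees $2k$ and $2k+1$ satisfying $(\ast)$, then with the constant $$c=\beta-\frac{1}{2\pi i}\oint_\gamma\frac{q_{2k+1}(\zeta)}{\zeta^{2k+1}}\,d\zeta$$ and with $\zeta=(z+\beta^2)^{1/2}$ the principal branch of the square root (i.e. $\operatorname{Re}\zeta>0$), we have $$P_k(z)=\begin{pmatrix}\sqrt{\frac{1+\alpha_1}{1+\alpha_2}} & 0 \\ 0 & 1\end{pmatrix}\begin{pmatrix}1 & 0 \\ c & 1\end{pmatrix}\begin{pmatrix}q_{2k}(\zeta) & q_{2k}(-\zeta) \\ q_{2k+1}(\zeta) & q_{2k+1}(-\zeta)\end{pmatrix}\begin{pmatrix}\sqrt{\frac{1+\alpha_1}{1+\alpha_2}} & \sqrt{\frac{1+\alpha_1}{1+\alpha_2}} \\ \zeta+\beta & -\zeta+\beta\end{pmatrix}^{-1}$$ $$=\begin{pmatrix}\sqrt{\frac{1+\alpha_1}{1+\alpha_2}} & 0 \\ 0 & 1\end{pmatrix}\begin{pmatrix}1 & 0 \\ c & 1\end{pmatrix}\begin{pmatrix}\frac{q_{2k}(\zeta)+q_{2k}(-\zeta)}{2} & \frac{q_{2k}(\zeta)-q_{2k}(-\zeta)}{2\zeta} \\[2pt] \frac{q_{2k+1}(\zeta)+q_{2k+1}(-\zeta)}{2} & \frac{q_{2k+1}(\zeta)-q_{2k+1}(-\zeta)}{2\zeta}\end{pmatrix}\begin{pmatrix}1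 & 0 \\ -\beta & 1\end{pmatrix}\begin{pmatrix}\sqrt{\frac{1+\alpha_2}{1+\alpha_1}} & 0 \\ 0 & 1\end{pmatrix}.$$
   Context: A monic matrix-valued polynomial of degree $k$ and size $2\times 2$ is $P_k(z)=z^kI_2+\sum_{i=0}^{k-1}C_iz^i$ with $C_i\in\mathbb{C}^{2\times2}$; integrals are taken entrywise. Existence and uniqueness of $P_k$ under the stated hypotheses is known and may be taken as given. *)

theory Defs
  imports "HOL-Complex_Analysis.Complex_Analysis" "HOL-Computational_Algebra.Polynomial"
begin

type_synonym cmat = "complex^2^2"

definition mat2 :: "complex \<Rightarrow> complex \<Rightarrow> complex \<Rightarrow> complex \<Rightarrow> cmat" where
  "mat2 a b c d = vector [vector [a, b], vector [c, d]]"

definition cscale :: "complex \<Rightarrow> cmat \<Rightarrow> cmat" where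
  "cscale c A = (\<chi> i j. c * A $ i $ j)"

text \<open>The library product \<open>*\<close>, and hence \<open>^\<close>, on vectors is componentwise, so powers with
  respect to the matrix product need a separate definition.\<close>

primrec mat_power :: "cmat \<Rightarrow> nat \<Rightarrow> cmat" where
  "mat_power A 0 = mat 1"
| "mat_power A (Suc n) = A ** mat_power A n"

definition monic_matrix_poly :: "nat \<Rightarrow> (complex \<Rightarrow> cmat) \<Rightarrow> bool" where
  "monic_matrix_poly k P \<longleftrightarrow>
     (\<exists>C :: nat \<Rightarrow> cmat. \<forall>z. P z = cscale (z ^ k) (mat 1) + (\<Sum>i<k. cscale (z ^ i) (C i)))"

definition monic_poly :: "nat \<Rightarrow> complex poly \<Rightarrow> bool" where
  "monic_poly n q \<longleftrightarrow> degree q = n \<and> lead_coeff q = 1"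

definition matrix_contour_integral :: "(real \<Rightarrow> complex) \<Rightarrow> (complex \<Rightarrow> cmat) \<Rightarrow> cmat" where
  "matrix_contour_integral g F = (\<chi> i j. contour_integral g (\<lambda>z. F z $ i $ j))"

definition goes_once_around_0 :: "(real \<Rightarrow> complex) \<Rightarrow> bool" where
  "goes_once_around_0 g \<longleftrightarrow>
     valid_path g \<and> pathfinish g = pathstart g \<and> 0 \<notin> path_image g \<and> winding_number g 0 = 1"

definition W :: "real \<Rightarrow> complex \<Rightarrow> cmat" where
  "W \<alpha> z = mat2 (of_real \<alpha>) 1 z 1"

text \<open>For even \<open>L\<close> the exponent \<open>L div 2\<close> is exactly \<open>L/2\<close>.\<close>

definition matrix_weight :: "nat \<Rightarrow> nat \<Rightarrow> real \<Rightarrow> real \<Rightarrow> complex \<Rightarrow> cmat" where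
  "matrix_weight K L \<alpha>1 \<alpha>2 z = cscale (1 / z ^ K) (mat_power (W \<alpha>1 z ** W \<alpha>2 z) (L div 2))"

definition is_mvop ::
  "nat \<Rightarrow> nat \<Rightarrow> nat \<Rightarrow> real \<Rightarrow> real \<Rightarrow> (real \<Rightarrow> complex) \<Rightarrow> (complex \<Rightarrow> cmat) \<Rightarrow> bool" where
  "is_mvop K L k \<alpha>1 \<alpha>2 g P \<longleftrightarrow>
     monic_matrix_poly k P \<and>
     (\<forall>j<k. cscale (1 / (2 * of_real pi * \<i>))
               (matrix_contour_integral g
                  (\<lambda>z. cscale (z ^ j) (P z ** matrix_weight K L \<alpha>1 \<alpha>2 z))) = 0)"

definition beta :: "real \<Rightarrow> real \<Rightarrow> real" where
  "beta \<alpha>1 \<alpha>2 = (1 - \<alpha>1 * \<alpha>2) / (2 * sqrt (1 + \<alpha>1) * sqrt (1 + \<alpha>2))"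

text \<open>The third argument is \<open>\<alpha>\<^sub>j\<close>: thus \<open>\<eta>\<^sub>j = eta \<alpha>\<^sub>1 \<alpha>\<^sub>2 \<alpha>\<^sub>j\<close>.\<close>

definition eta :: "real \<Rightarrow> real \<Rightarrow> real \<Rightarrow> real" where
  "eta \<alpha>1 \<alpha>2 \<alpha> = - (1 + 2 * \<alpha> + \<alpha>1 * \<alpha>2) / (2 * sqrt (1 + \<alpha>1) * sqrt (1 + \<alpha>2))"

definition scalar_weight :: "nat \<Rightarrow> nat \<Rightarrow> real \<Rightarrow> real \<Rightarrow> complex \<Rightarrow> complex" where
  "scalar_weight K L \<alpha>1 \<alpha>2 \<zeta> =
     ((\<zeta> - of_real (eta \<alpha>1 \<alpha>2 \<alpha>1)) * (\<zeta> - of_real (eta \<alpha>1 \<alpha>2 \<alpha>2))) ^ (L div 2)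
       / (\<zeta>\<^sup>2 - (of_real (beta \<alpha>1 \<alpha>2))\<^sup>2) ^ K"

text \<open>The orthogonality of \<open>q\<^sub>2\<^sub>k\<close> and of \<open>q\<^sub>2\<^sub>k\<^sub>+\<^sub>1\<close> is the same condition, with
  \<open>j = 0, \<dots>, 2k - 1\<close> in both cases.\<close>

definition scalar_orth ::
  "nat \<Rightarrow> nat \<Rightarrow> nat \<Rightarrow> real \<Rightarrow> real \<Rightarrow> real \<Rightarrow> complex poly \<Rightarrow> bool" where
  "scalar_orth K L k \<alpha>1 \<alpha>2 R q \<longleftrightarrow>
     (\<forall>j<2*k. 1 / (2 * of_real pi * \<i>) *
        contour_integral (circlepath 0 R)
          (\<lambda>\<zeta>. poly q \<zeta> * \<zeta> ^ j * scalar_weight K L \<alpha>1 \<alpha>2 \<zeta>) = 0)"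

end

theory Submission
  imports Defs
begin

text \<open>
  The two orthogonality conditions turn into the same statement about coefficients of polynomials,
  because the substitution \<open>z = \<zeta>\<^sup>2 - \<beta>\<^sup>2\<close> diagonalises the matrix weight.

  The matrix \<open>W \<alpha>1 z ** W \<alpha>2 z\<close> has trace \<open>2z + 1 + \<alpha>1\<alpha>2\<close> and determinant \<open>(z - \<alpha>1)(z - \<alpha>2)\<close>,
  and the discriminant of its characteristic polynomial is a constant times \<open>z + \<beta>\<^sup>2\<close>. In the
  variable \<open>\<zeta>\<close> the eigenvalues are therefore polynomials, namely \<open>\<lambda>(\<zeta>) = (\<zeta> - \<eta>\<^sub>1)(\<zeta> - \<eta>\<^sub>2)\<close> and
  \<open>\<lambda>(-\<zeta>)\<close>, and an eigenvector for \<open>\<lambda>(\<zeta>)\<close> is \<open>(s, \<zeta> + \<beta>)\<close> with \<open>s = sqrt ((1 + \<alpha>1) / (1 + \<alpha>2))\<close>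
  (\<open>W_product_eigenvector\<close>). So a row \<open>(f, g)\<close> of polynomials in \<open>z\<close> gives a scalar polynomial
  \<open>q(\<zeta>) = s f(z) + (\<zeta> + \<beta>) g(z)\<close> in \<open>\<zeta>\<close>, and multiplying the row by the \<open>n\<close>-th power of the matrix
  product multiplies \<open>q\<close> by \<open>\<lambda>(\<zeta>)\<^sup>n\<close>. Here \<open>g(z)\<close> is the odd part of \<open>q\<close> divided by \<open>\<zeta>\<close>, and \<open>s f(z) + \<beta> g(z)\<close>
  is its even part, so every \<open>q\<close> comes from exactly one row.

  Let \<open>(A, B)\<close> be such a row after multiplication by the polynomial part of the weight. The matrix
  condition says that the integrals of \<open>A z\<^sup>j / z\<^sup>K\<close> and \<open>B z\<^sup>j / z\<^sup>K\<close> vanish for \<open>j < k\<close>, that is, that \<open>A\<close> and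
  \<open>B\<close> have no terms of degrees \<open>K - k, \<dots>, K - 1\<close> (\<open>is_mvop_eval_mat_iff\<close>). The scalar condition
  involves integrals over a circle that is symmetric under \<open>\<zeta> \<mapsto> -\<zeta>\<close>: even integrands contribute
  nothing, and for odd ones \<open>2\<zeta> d\<zeta> = dz\<close> leads back to a coefficient in \<open>z\<close>. The exponents \<open>2i\<close> and
  \<open>2i + 1\<close> test \<open>B\<close> and \<open>s A + \<beta> B\<close> against \<open>(z + \<beta>\<^sup>2)\<^sup>i\<close>, \<open>i < k\<close>, and these powers span the same space
  as \<open>z\<^sup>i\<close>, \<open>i < k\<close>. Hence both conditions agree row by row (\<open>scalar_orth_row_poly_iff\<close>).

  It remains to match leading coefficients (\<open>row_poly_coeffs\<close>). From \<open>P\<close> to the scalar polynomials this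
  is immediate. Conversely, the matrix built from the rows of \<open>s q\<^sub>2\<^sub>k\<close> and \<open>q\<^sub>2\<^sub>k\<^sub>+\<^sub>1 + c q\<^sub>2\<^sub>k\<close> satisfies the
  orthogonality conditions for every \<open>c\<close>, and the stated \<open>c\<close> is the one for which the lower left entry
  has degree less than \<open>k\<close>; uniqueness identifies the matrix with \<open>P\<close>.
\<close>

(* Throughout, $ denotes an entry of a vector or matrix, never a coefficient of a power series. *)
no_notation fps_nth (infixl \<open>$\<close> 75)

section \<open>Integrals that read off a coefficient\<close>

text \<open>
  All monomials \<open>u\<^sup>i u' / u\<^sup>m\<^sup>+\<^sup>1\<close> other than \<open>u' / u\<close> have a single-valued primitive. The inner function \<open>u\<close> is
  kept general because it is applied with \<open>u(z) = z\<close> and with \<open>u(\<zeta>) = \<zeta>\<^sup>2 - b\<^sup>2\<close>.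
\<close>

lemma has_contour_integral_poly_over_power:
  fixes u u' :: "complex \<Rightarrow> complex"
  assumes path: "valid_path g" "pathfinish g = pathstart g"
    and deriv: "\<And>z. (u has_field_derivative u' z) (at z)"
    and nz: "\<And>z. z \<in> path_image g \<Longrightarrow> u z \<noteq> 0"
    and log_int: "((\<lambda>z. u' z / u z) has_contour_integral I) g"
  shows "((\<lambda>z. u' z * poly p (u z) / u z ^ Suc m) has_contour_integral coeff p m * I) g"
proof -
  have monomial: "((\<lambda>z. coeff p i * (u' z * u z ^ i / u z ^ Suc m))
      has_contour_integral coeff p i * (if i = m then I else 0)) g" for i
  proof (rule has_contour_integral_lmul)
    show "((\<lambda>z. u' z * u z ^ i / u z ^ Suc m) has_contour_integral (if i = m then I else 0)) g"
    proof (cases "i = m")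
      case True
      show ?thesis
        unfolding True if_True simp_thms
        by (rule has_contour_integral_eq[OF log_int]) (simp add: nz)
    next
      case False
      \<comment> \<open>The integrand is \<open>u' u\<^sup>e\<^sup>-\<^sup>1\<close>; integer exponents treat \<open>i < m\<close> and \<open>i > m\<close> alike.\<close>
      define e where "e = int i - int m"
      have e: "e \<noteq> 0"
        using False by (simp add: e_def)
      have "((\<lambda>z. u' z * u z powi (e - 1)) has_contour_integral 0) g"
      proof (rule Cauchy_theorem_primitive[where S = "path_image g"])
        show "((\<lambda>z. u z powi e / of_int e) has_field_derivative u' z * u z powi (e - 1))
            (at z within path_image g)" if "z \<in> path_image g" for z
          using e nz[OF that]
          by (auto intro!: derivative_eq_intros DERIV_subset[OF deriv] simp: field_simps)
      qed (use path in auto)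
      moreover have "u' z * u z powi (e - 1) = u' z * u z ^ i / u z ^ Suc m"
        if "z \<in> path_image g" for z
      proof -
        have "u z powi (e - 1) = u z powi (int i - int (Suc m))"
          by (simp add: e_def algebra_simps)
        also have "\<dots> = u z ^ i / u z ^ Suc m"
          using nz[OF that] by (simp add: power_int_diff del: power_Suc of_nat_Suc)
        finally show ?thesis by simp
      qed
      ultimately show ?thesis
        using False by (auto elim: has_contour_integral_eq)
    qed
  qed
  have "((\<lambda>z. \<Sum>i\<le>degree p. coeff p i * (u' z * u z ^ i / u z ^ Suc m))
      has_contour_integral (\<Sum>i\<le>degree p. coeff p i * (if i = m then I else 0))) g"
    by (rule has_contour_integral_sum) (use monomial in auto)
  also have "(\<Sum>i\<le>degree p. coeff p i * (if i = m then I else 0)) = coeff p m * I"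
    by (simp add: if_distrib[where f = "\<lambda>x. _ * x"] coeff_eq_0 cong: if_cong)
  finally show ?thesis
    by (simp add: poly_altdef sum_distrib_left sum_distrib_right sum_divide_distrib mult_ac)
qed

lemma contour_integral_poly_over_power:
  assumes "goes_once_around_0 g"
  shows "contour_integral g (\<lambda>z. poly p z / z ^ Suc m) = 2 * of_real pi * \<i> * coeff p m"
proof -
  have g: "valid_path g" "pathfinish g = pathstart g" "0 \<notin> path_image g" "winding_number g 0 = 1"
    using assms by (auto simp: goes_once_around_0_def)
  have "((\<lambda>z. 1 / z) has_contour_integral 2 * of_real pi * \<i>) g"
    using has_contour_integral_winding_number[OF g(1,3)] g(4) by simp
  with has_contour_integral_poly_over_power[where u = "\<lambda>z. z" and u' = "\<lambda>_. 1" and g = g and p = p and m = m]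
  have "((\<lambda>z. poly p z / z ^ Suc m) has_contour_integral coeff p m * (2 * of_real pi * \<i>)) g"
    using g by auto
  then show ?thesis
    by (simp add: contour_integral_unique)
qed

lemma quadratic_nonzero_on_circle:
  fixes b :: complex
  assumes "norm b < R" "\<zeta> \<in> path_image (circlepath 0 R)"
  shows "\<zeta>\<^sup>2 - b\<^sup>2 \<noteq> 0"
proof -
  have "norm \<zeta> = R"
    using assms(2) order.strict_trans1[OF norm_ge_zero assms(1)] by (simp add: path_image_circlepath_nonneg)
  then show ?thesis
    using assms(1) by (auto simp: power2_eq_iff)
qed

text \<open>
  With \<open>z = \<zeta>\<^sup>2 - b\<^sup>2\<close> the circle is mapped to a curve winding twice around \<open>0\<close>, which compensates the factor
  \<open>1/2\<close> in \<open>\<zeta> d\<zeta> = dz / 2\<close>. The winding is computed from the partial fractions of \<open>2\<zeta> / (\<zeta>\<^sup>2 - b\<^sup>2)\<close>,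
  which remains correct for \<open>b = 0\<close>.
\<close>

lemma contour_integral_odd_over_quadratic:
  fixes b :: complex
  assumes "norm b < R"
  shows "contour_integral (circlepath 0 R) (\<lambda>\<zeta>. \<zeta> * poly p (\<zeta>\<^sup>2 - b\<^sup>2) / (\<zeta>\<^sup>2 - b\<^sup>2) ^ Suc m)
    = 2 * of_real pi * \<i> * coeff p m"
proof -
  let ?g = "circlepath 0 R"
  have "((\<lambda>\<zeta>. 2 * \<zeta> / (\<zeta>\<^sup>2 - b\<^sup>2)) has_contour_integral 2 * (2 * of_real pi * \<i>)) ?g"
  proof (rule has_contour_integral_eq)
    have wind: "((\<lambda>\<zeta>. 1 / (\<zeta> - c)) has_contour_integral 2 * of_real pi * \<i>) ?g"
      if "norm c < R" for c
      using has_contour_integral_winding_number[of ?g c] winding_number_circlepath[of c 0 R] that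
      by simp
    show "((\<lambda>\<zeta>. 1 / (\<zeta> - b) + 1 / (\<zeta> - (- b))) has_contour_integral 2 * (2 * of_real pi * \<i>)) ?g"
      using has_contour_integral_add[OF wind[of b] wind[of "- b"]] assms by (simp add: mult.commute)
    show "1 / (\<zeta> - b) + 1 / (\<zeta> - - b) = 2 * \<zeta> / (\<zeta>\<^sup>2 - b\<^sup>2)" if "\<zeta> \<in> path_image ?g" for \<zeta>
    proof -
      have "\<zeta>\<^sup>2 - b\<^sup>2 = (\<zeta> - b) * (\<zeta> + b)"
        by (simp add: power2_eq_square algebra_simps)
      moreover from this have "\<zeta> - b \<noteq> 0" "\<zeta> + b \<noteq> 0"
        using quadratic_nonzero_on_circle[OF assms that] by auto
      ultimately show ?thesis
        by (simp add: add_frac_eq)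
    qed
  qed
  then have *: "((\<lambda>\<zeta>. (2 * \<zeta>) / (\<zeta>\<^sup>2 - b\<^sup>2)) has_contour_integral 2 * (2 * of_real pi * \<i>)) ?g"
    by simp
  have deriv: "((\<lambda>\<zeta>. \<zeta>\<^sup>2 - b\<^sup>2) has_field_derivative 2 * \<zeta>) (at \<zeta>)" for \<zeta>
    by (auto intro!: derivative_eq_intros)
  from has_contour_integral_poly_over_power[OF _ _ this _ *, where p = p and m = m]
  have "((\<lambda>\<zeta>. 2 * \<zeta> * poly p (\<zeta>\<^sup>2 - b\<^sup>2) / (\<zeta>\<^sup>2 - b\<^sup>2) ^ Suc m)
      has_contour_integral coeff p m * (2 * (2 * of_real pi * \<i>))) ?g"
    using quadratic_nonzero_on_circle[OF assms] by simp
  from has_contour_integral_div[OF this, of 2] show ?thesis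
    by (intro contour_integral_unique) (simp add: mult_ac)
qed

text \<open>
  Negation rotates the circle by half a turn, so it preserves the integral, while it changes the sign
  of \<open>d\<zeta>\<close>.
\<close>

lemma contour_integral_even_circlepath:
  assumes even: "\<And>z. f (- z) = f z"
  shows "contour_integral (circlepath 0 R) f = 0"
proof -
  let ?g = "circlepath 0 R"
  have exp_half: "exp (2 * of_real pi * \<i> * of_real (x + 1 / 2)) = - exp (2 * of_real pi * \<i> * of_real x)"
    "exp (2 * of_real pi * \<i> * of_real (x - 1 / 2)) = - exp (2 * of_real pi * \<i> * of_real x)" for x
    by (simp_all add: algebra_simps exp_add exp_diff)
  have "shiftpath (1 / 2) ?g = uminus \<circ> ?g"
    using exp_half
    by (auto simp: shiftpath_def circlepath fun_eq_iff add.commute[of "1 / 2 :: real"]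
      simp flip: diff_divide_distrib)
  then have "contour_integral ?g f = contour_integral (uminus \<circ> ?g) f"
    using contour_integral_shiftpath[of ?g "1 / 2" f] by simp
  also have "\<dots> = - contour_integral ?g f"
    by (simp add: contour_integral_negatepath even)
  finally show ?thesis by simp
qed

section \<open>Windows of vanishing coefficients\<close>

text \<open>
  For \<open>k \<le> K\<close>, the case of interest, these are the degrees from \<open>K - k\<close> to \<open>K - 1\<close>; the coefficient
  of degree \<open>K - Suc j\<close> is the residue at \<open>0\<close> of \<open>f(z) z\<^sup>j / z\<^sup>K\<close>.
\<close>

definition window_zero :: "nat \<Rightarrow> nat \<Rightarrow> complex poly \<Rightarrow> bool" where
  "window_zero K k f \<longleftrightarrow> (\<forall>j<k. coeff f (K - Suc j) = 0)"

lemma monic_linear_power: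
  fixes c :: complex
  shows "degree ([:c, 1:] ^ i) = i" "coeff ([:c, 1:] ^ i) i = 1"
  using degree_linear_power[of c i] lead_coeff_power[of "[:c, 1:]" i] by simp_all

text \<open>
  The powers of \<open>z + c\<close> with exponent below \<open>k\<close> are a unitriangular change of basis of the polynomials
  of degree less than \<open>k\<close>, so testing against them is the same as testing against monomials.
\<close>

lemma window_zero_linear_power_iff:
  assumes "k \<le> Suc m"
  shows "(\<forall>i<k. coeff ([:c, 1:] ^ i * f) m = 0) \<longleftrightarrow> window_zero (Suc m) k f"
proof
  assume *: "\<forall>i<k. coeff ([:c, 1:] ^ i * f) m = 0"
  have "coeff f (m - i) = 0" if "i < k" for i
    using that
  proof (induction i rule: less_induct)
    case (less i)
    let ?t = "\<lambda>r. coeff ([:c, 1:] ^ i) r * coeff f (m - r)"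
    have "?t r = 0" if "r \<noteq> i" for r
    proof (cases "r < i")
      case True
      then show ?thesis using less by simp
    next
      case False
      then have "coeff ([:c, 1:] ^ i) r = 0"
        using that by (intro coeff_eq_0) (simp add: monic_linear_power)
      then show ?thesis by simp
    qed
    then have "(\<Sum>r\<le>m. ?t r) = (\<Sum>r\<in>{i}. ?t r)"
      using less.prems assms by (intro sum.mono_neutral_right) auto
    then have "coeff ([:c, 1:] ^ i * f) m = coeff f (m - i)"
      by (simp add: coeff_mult monic_linear_power)
    with * less.prems show ?case by simp
  qed
  then show "window_zero (Suc m) k f"
    by (simp add: window_zero_def)
next
  assume *: "window_zero (Suc m) k f"
  have summand: "coeff ([:c, 1:] ^ i) r * coeff f (m - r) = 0" if "i < k" for i r
  proof (cases "r < k")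
    case True
    then show ?thesis using * by (simp add: window_zero_def)
  next
    case False
    then have "coeff ([:c, 1:] ^ i) r = 0"
      using that by (intro coeff_eq_0) (simp add: monic_linear_power)
    then show ?thesis by simp
  qed
  show "\<forall>i<k. coeff ([:c, 1:] ^ i * f) m = 0"
    unfolding coeff_mult by (intro allI impI sum.neutral ballI summand)
qed

section \<open>Splitting a polynomial into even and odd part\<close>

text \<open>
  The even part and the odd part are both written in the variable \<open>z = \<zeta>\<^sup>2 - b\<^sup>2\<close> instead of \<open>\<zeta>\<^sup>2\<close>, since \<open>z\<close>
  is the variable of the matrices and its power is the denominator of the scalar weight.
\<close>

definition even_odd_poly :: "complex \<Rightarrow> complex poly \<Rightarrow> complex poly \<Rightarrow> complex poly" where
  "even_odd_poly b A B = A \<circ>\<^sub>p [:- (b\<^sup>2), 0, 1:] + [:0, 1:] * (B \<circ>\<^sub>p [:- (b\<^sup>2), 0, 1:])"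

lemma poly_even_odd_poly: "poly (even_odd_poly b A B) \<zeta> = poly A (\<zeta>\<^sup>2 - b\<^sup>2) + \<zeta> * poly B (\<zeta>\<^sup>2 - b\<^sup>2)"
  by (simp add: even_odd_poly_def poly_pcompose power2_eq_square)

lemma even_odd_poly_add: "even_odd_poly b A B + even_odd_poly b A' B' = even_odd_poly b (A + A') (B + B')"
  by (simp add: even_odd_poly_def pcompose_add algebra_simps)

lemma smult_even_odd_poly: "smult c (even_odd_poly b A B) = even_odd_poly b (smult c A) (smult c B)"
  by (simp add: even_odd_poly_def pcompose_smult smult_add_right)

lemma even_odd_poly_pCons:
  "even_odd_poly b (pCons c A) (pCons d B) = [:c, d:] + [:- (b\<^sup>2), 0, 1:] * even_odd_poly b A B"
  by (simp add: even_odd_poly_def pcompose_pCons algebra_simps)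

text \<open>
  Two coefficients are removed at a time: \<open>q(\<zeta>) = c + d\<zeta> + \<zeta>\<^sup>2 r(\<zeta>)\<close>, and the factor \<open>\<zeta>\<^sup>2\<close> is \<open>z + b\<^sup>2\<close> in
  terms of \<open>z = \<zeta>\<^sup>2 - b\<^sup>2\<close>.
\<close>

lemma even_odd_poly_exists:
  assumes "degree q \<le> 2 * k + 1"
  obtains A B where "q = even_odd_poly b A B" "degree A \<le> k" "degree B \<le> k"
proof -
  have "\<exists>A B. q = even_odd_poly b A B \<and> degree A \<le> k \<and> degree B \<le> k"
    using assms
  proof (induction k arbitrary: q)
    case 0
    obtain c p where q: "q = pCons c p" by (cases q)
    have "degree p = 0"
      using 0 q by (cases "p = 0") auto
    then obtain d where "p = [:d:]" by (rule degree_eq_zeroE)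
    then have "q = even_odd_poly b [:c:] [:d:]"
      using q by (simp add: even_odd_poly_def)
    then show ?case
      by (intro exI[of _ "[:c:]"] exI[of _ "[:d:]"]) simp
  next
    case (Suc k)
    obtain c p where q: "q = pCons c p" by (cases q)
    obtain d r where p: "p = pCons d r" by (cases p)
    have "degree r \<le> 2 * k + 1"
      using Suc.prems q p by (auto split: if_splits)
    then obtain A B where AB: "r = even_odd_poly b A B" "degree A \<le> k" "degree B \<le> k"
      using Suc.IH by blast
    have deg: "degree ([:c:] + [:b\<^sup>2, 1:] * A) \<le> Suc k" if "degree A \<le> k" for c A
      by (rule degree_add_le) (use that degree_mult_le[of "[:b\<^sup>2, 1:]" A] in auto)
    have "poly q x = poly (even_odd_poly b ([:c:] + [:b\<^sup>2, 1:] * A) ([:d:] + [:b\<^sup>2, 1:] * B)) x" for x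
      by (simp add: q p AB(1) poly_even_odd_poly algebra_simps power2_eq_square)
    then have "q = even_odd_poly b ([:c:] + [:b\<^sup>2, 1:] * A) ([:d:] + [:b\<^sup>2, 1:] * B)"
      by (auto simp: fun_eq_iff simp flip: poly_eq_poly_eq_iff)
    with deg AB(2,3) show ?case by blast
  qed
  with that show thesis by blast
qed

lemma even_odd_poly_coeffs:
  assumes "degree A \<le> k" "degree B \<le> k"
  shows "degree (even_odd_poly b A B) \<le> 2 * k + 1"
    and "coeff (even_odd_poly b A B) (2 * k + 1) = coeff B k"
    and "coeff (even_odd_poly b A B) (2 * k) = coeff A k"
proof -
  have "degree (even_odd_poly b A B) \<le> 2 * k + 1 \<and>
    coeff (even_odd_poly b A B) (2 * k + 1) = coeff B k \<and> coeff (even_odd_poly b A B) (2 * k) = coeff A k"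
    using assms
  proof (induction k arbitrary: A B)
    case 0
    then obtain c d where "A = [:c:]" "B = [:d:]"
      by (auto elim!: degree_eq_zeroE)
    then show ?case by (simp add: even_odd_poly_def)
  next
    case (Suc k)
    obtain c A' where A: "A = pCons c A'" by (cases A)
    obtain d B' where B: "B = pCons d B'" by (cases B)
    let ?J = "even_odd_poly b A' B'"
    have "degree A' \<le> k" "degree B' \<le> k"
      using Suc.prems A B by (auto split: if_splits)
    from Suc.IH[OF this] have J: "degree ?J \<le> 2 * k + 1" "coeff ?J (2 * k + 1) = coeff B' k"
      "coeff ?J (2 * k) = coeff A' k"
      by auto
    have "coeff (even_odd_poly b A B) (Suc (Suc n)) = coeff ?J n - b\<^sup>2 * coeff ?J (Suc (Suc n))" for n
      by (simp add: A B even_odd_poly_pCons)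
    from this[of "2 * k"] this[of "2 * k + 1"] J
    have "coeff (even_odd_poly b A B) (2 * Suc k) = coeff A' k"
      "coeff (even_odd_poly b A B) (2 * Suc k + 1) = coeff B' k"
      by (simp_all add: coeff_eq_0)
    moreover have "degree ([:- (b\<^sup>2), 0, 1:] * ?J) \<le> 2 * Suc k + 1"
      using degree_mult_le[of "[:- (b\<^sup>2), 0, 1:]" ?J] J(1) by simp
    then have "degree (even_odd_poly b A B) \<le> 2 * Suc k + 1"
      unfolding A B even_odd_poly_pCons by (intro degree_add_le) auto
    ultimately show ?case by (simp add: A B)
  qed
  then show "degree (even_odd_poly b A B) \<le> 2 * k + 1"
    "coeff (even_odd_poly b A B) (2 * k + 1) = coeff B k" "coeff (even_odd_poly b A B) (2 * k) = coeff A k"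
    by auto
qed


section \<open>Orthogonality on the circle in terms of coefficients\<close>

lemma contour_integrable_over_quadratic:
  fixes b :: complex
  assumes "norm b < R" "continuous_on UNIV f"
  shows "(\<lambda>\<zeta>. f \<zeta> / (\<zeta>\<^sup>2 - b\<^sup>2) ^ K) contour_integrable_on circlepath 0 R"
  using quadratic_nonzero_on_circle[OF assms(1)] continuous_on_subset[OF assms(2) subset_UNIV]
  by (intro contour_integrable_continuous_circlepath continuous_intros) auto

lemma contour_integral_even_odd_poly:
  fixes b :: complex
  assumes "norm b < R"
  shows "contour_integral (circlepath 0 R) (\<lambda>\<zeta>. poly (even_odd_poly b A B) \<zeta> / (\<zeta>\<^sup>2 - b\<^sup>2) ^ Suc m)
    = 2 * of_real pi * \<i> * coeff B m"
proof -
  let ?g = "circlepath 0 R"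
  have cont: "continuous_on UNIV (\<lambda>\<zeta>. poly p (\<zeta>\<^sup>2 - b\<^sup>2))" for p
    by (intro continuous_intros)
  have "contour_integral ?g (\<lambda>\<zeta>. poly A (\<zeta>\<^sup>2 - b\<^sup>2) / (\<zeta>\<^sup>2 - b\<^sup>2) ^ Suc m
      + \<zeta> * poly B (\<zeta>\<^sup>2 - b\<^sup>2) / (\<zeta>\<^sup>2 - b\<^sup>2) ^ Suc m) =
    contour_integral ?g (\<lambda>\<zeta>. poly A (\<zeta>\<^sup>2 - b\<^sup>2) / (\<zeta>\<^sup>2 - b\<^sup>2) ^ Suc m)
      + contour_integral ?g (\<lambda>\<zeta>. \<zeta> * poly B (\<zeta>\<^sup>2 - b\<^sup>2) / (\<zeta>\<^sup>2 - b\<^sup>2) ^ Suc m)"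
    by (intro contour_integral_add contour_integrable_over_quadratic[OF assms]
        continuous_intros cont)
  also have "contour_integral ?g (\<lambda>\<zeta>. poly A (\<zeta>\<^sup>2 - b\<^sup>2) / (\<zeta>\<^sup>2 - b\<^sup>2) ^ Suc m) = 0"
    by (intro contour_integral_even_circlepath) simp
  finally show ?thesis
    using contour_integral_odd_over_quadratic[OF assms, of B m]
    by (simp add: poly_even_odd_poly add_divide_distrib)
qed

text \<open>
  An odd power of \<open>\<zeta>\<close> exchanges the two parts, so that the even exponents test \<open>B\<close> and the odd ones
  test \<open>A\<close>.
\<close>

lemma even_odd_poly_power_mult:
  "poly (even_odd_poly b A B) \<zeta> * \<zeta> ^ (2 * i) = poly (even_odd_poly b ([:b\<^sup>2, 1:] ^ i * A) ([:b\<^sup>2, 1:] ^ i * B)) \<zeta>"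
  "poly (even_odd_poly b A B) \<zeta> * \<zeta> ^ (2 * i + 1) =
    poly (even_odd_poly b ([:b\<^sup>2, 1:] ^ Suc i * B) ([:b\<^sup>2, 1:] ^ i * A)) \<zeta>"
  by (simp_all add: poly_even_odd_poly power_mult algebra_simps power2_eq_square)

lemma all_less_double_iff: "(\<forall>j<2 * k. P j) \<longleftrightarrow> (\<forall>i<k. P (2 * i) \<and> P (2 * i + 1))" for k :: nat
proof (intro iffI allI impI)
  fix j assume "\<forall>i<k. P (2 * i) \<and> P (2 * i + 1)" "j < 2 * k"
  then show "P j"
    by (cases "even j") (auto elim!: evenE oddE)
qed auto

lemma orthogonal_even_odd_poly_iff:
  fixes b :: complex
  assumes "norm b < R" "k \<le> K"
  shows "(\<forall>j<2 * k. contour_integral (circlepath 0 R)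
      (\<lambda>\<zeta>. poly (even_odd_poly b A B) \<zeta> * \<zeta> ^ j / (\<zeta>\<^sup>2 - b\<^sup>2) ^ K) = 0) \<longleftrightarrow>
    window_zero K k A \<and> window_zero K k B"
proof (cases K)
  case 0
  then show ?thesis
    using assms by (simp add: window_zero_def)
next
  case (Suc m)
  show ?thesis
    unfolding all_less_double_iff even_odd_poly_power_mult Suc contour_integral_even_odd_poly[OF assms(1)]
    using window_zero_linear_power_iff[of k m "b\<^sup>2"] assms(2) Suc
    by auto
qed

section \<open>Matrices of polynomials\<close>

definition eval_mat :: "complex poly^2^2 \<Rightarrow> complex \<Rightarrow> cmat" where
  "eval_mat M z = (\<chi> i j. poly (M $ i $ j) z)"

lemma eval_mat_mult: "eval_mat (M ** N) z = eval_mat M z ** eval_mat N z"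
  by (simp add: eval_mat_def matrix_matrix_mult_def vec_eq_iff poly_sum)

lemma monic_matrix_poly_eval_mat_iff:
  "monic_matrix_poly k Q \<longleftrightarrow> (\<exists>M. Q = eval_mat M \<and>
     (\<forall>i j. degree (M $ i $ j) \<le> k \<and> coeff (M $ i $ j) k = (if i = j then 1 else 0)))"
  (is "_ \<longleftrightarrow> (\<exists>M. Q = eval_mat M \<and> ?monic M)")
proof
  assume "monic_matrix_poly k Q"
  then obtain C where C: "Q z = cscale (z ^ k) (mat 1) + (\<Sum>i<k. cscale (z ^ i) (C i))" for z
    by (auto simp: monic_matrix_poly_def)
  define M :: "complex poly^2^2" where
    "M = (\<chi> i j. monom (if i = j then 1 else 0) k + (\<Sum>n<k. monom (C n $ i $ j) n))"
  have "degree (monom (C n $ i $ j) n) \<le> k" if "n < k" for n i j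
    using order.trans[OF degree_monom_le[of "C n $ i $ j" n], of k] that by simp
  then have "degree (M $ i $ j) \<le> k" for i j
    unfolding M_def by (simp only: vec_lambda_beta) (intro degree_add_le degree_monom_le degree_sum_le; simp)
  moreover have "coeff (M $ i $ j) k = (if i = j then 1 else 0)" for i j
    by (simp add: M_def coeff_sum)
  moreover have "Q = eval_mat M"
    by (auto simp: fun_eq_iff C eval_mat_def M_def cscale_def mat_def vec_eq_iff poly_sum poly_monom
        mult.commute)
  ultimately show "\<exists>M. Q = eval_mat M \<and> ?monic M" by blast
next
  assume "\<exists>M. Q = eval_mat M \<and> ?monic M"
  then obtain M where M: "Q = eval_mat M" "?monic M" by blast
  have "poly (M $ i $ j) z = z ^ k * (if i = j then 1 else 0) + (\<Sum>n<k. z ^ n * coeff (M $ i $ j) n)"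
    for i j z
  proof -
    have "poly (M $ i $ j) z = (\<Sum>n\<le>k. coeff (M $ i $ j) n * z ^ n)"
      using M(2) by (auto simp: poly_altdef intro!: sum.mono_neutral_left coeff_eq_0)
    also have "{..k} = insert k {..<k}" by auto
    finally show ?thesis
      using M(2) by (simp add: mult.commute)
  qed
  then have "Q z = cscale (z ^ k) (mat 1)
      + (\<Sum>n<k. cscale (z ^ n) (\<chi> i j. coeff (M $ i $ j) n))" for z
    by (simp add: M(1) eval_mat_def cscale_def mat_def vec_eq_iff)
  then show "monic_matrix_poly k Q"
    by (auto simp: monic_matrix_poly_def)
qed

lemma mat2_nth [simp]:
  "mat2 a b c d $ 1 $ 1 = a" "mat2 a b c d $ 1 $ 2 = b"
  "mat2 a b c d $ 2 $ 1 = c" "mat2 a b c d $ 2 $ 2 = d"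
  by (simp_all add: mat2_def)

lemma mat2_eq_iff:
  "A = B \<longleftrightarrow> A $ 1 $ 1 = B $ 1 $ 1 \<and> A $ 1 $ 2 = B $ 1 $ 2 \<and>
     A $ 2 $ 1 = B $ 2 $ 1 \<and> A $ 2 $ 2 = B $ 2 $ 2" for A B :: "'a^2^2"
  by (auto simp: vec_eq_iff forall_2)

lemma matrix_mult_2: "(A ** B) $ i $ j = A $ i $ 1 * B $ 1 $ j + A $ i $ 2 * B $ 2 $ j"
  for A B :: "'a::semiring_1^2^2"
  by (simp add: matrix_matrix_mult_def sum_2)

lemma mat2_mult:
  "mat2 a b c d ** mat2 a' b' c' d' =
     mat2 (a * a' + b * c') (a * b' + b * d') (c * a' + d * c') (c * b' + d * d')"
  by (simp add: mat2_eq_iff matrix_mult_2)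

lemma W_product_power_polynomial:
  "\<exists>N. \<forall>z. mat_power (W \<alpha>1 z ** W \<alpha>2 z) n = eval_mat N z"
proof (induction n)
  case 0
  have "mat_power (W \<alpha>1 z ** W \<alpha>2 z) 0 = eval_mat (mat 1) z" for z
    by (simp add: eval_mat_def mat_def vec_eq_iff)
  then show ?case by blast
next
  case (Suc n)
  then obtain N where N: "mat_power (W \<alpha>1 z ** W \<alpha>2 z) n = eval_mat N z" for z by blast
  define V :: "real \<Rightarrow> complex poly^2^2" where
    "V \<alpha> = vector [vector [[:of_real \<alpha>:], 1], vector [[:0, 1:], 1]]" for \<alpha>
  have "W \<alpha> z = eval_mat (V \<alpha>) z" for \<alpha> z
    by (simp add: W_def V_def eval_mat_def mat2_eq_iff)
  then have "mat_power (W \<alpha>1 z ** W \<alpha>2 z) (Suc n) = eval_mat (V \<alpha>1 ** V \<alpha>2 ** N) z" for z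
    using N[of z] by (simp add: eval_mat_mult)
  then show ?case by blast
qed

lemma is_mvop_eval_mat_iff:
  assumes g: "goes_once_around_0 g" and "k \<le> K"
    and N: "\<And>z. mat_power (W \<alpha>1 z ** W \<alpha>2 z) (L div 2) = eval_mat N z"
  shows "is_mvop K L k \<alpha>1 \<alpha>2 g (eval_mat M) \<longleftrightarrow>
    monic_matrix_poly k (eval_mat M) \<and> (\<forall>i l. window_zero K k ((M ** N) $ i $ l))"
proof -
  have "contour_integral g (\<lambda>z. cscale (z ^ j) (eval_mat M z ** matrix_weight K L \<alpha>1 \<alpha>2 z) $ i $ l)
      = 2 * of_real pi * \<i> * coeff ((M ** N) $ i $ l) (K - Suc j)" if j: "j < k" for i l j
  proof -
    obtain m where m: "K = Suc m" "j \<le> m"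
      using j \<open>k \<le> K\<close> by (cases K) auto
    have "cscale (z ^ j) (eval_mat M z ** matrix_weight K L \<alpha>1 \<alpha>2 z) $ i $ l
        = poly (monom 1 j * (M ** N) $ i $ l) z / z ^ Suc m" for z
      by (simp add: matrix_weight_def N m cscale_def matrix_mult_2 eval_mat_def poly_monom algebra_simps
          add_divide_distrib)
    then show ?thesis
      using contour_integral_poly_over_power[OF g, of "monom 1 j * (M ** N) $ i $ l" m] m
      by (simp add: coeff_monom_mult)
  qed
  then show ?thesis
    by (auto simp: is_mvop_def matrix_contour_integral_def cscale_def vec_eq_iff window_zero_def)
qed

section \<open>Diagonalisation of the weight\<close>

definition ratio_root :: "real \<Rightarrow> real \<Rightarrow> complex" where
  "ratio_root \<alpha>1 \<alpha>2 = complex_of_real (sqrt ((1 + \<alpha>1) / (1 + \<alpha>2)))"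

lemma ratio_root_swap:
  assumes "\<alpha>1 > 0" "\<alpha>2 > 0"
  shows "ratio_root \<alpha>1 \<alpha>2 * ratio_root \<alpha>2 \<alpha>1 = 1"
  using assms by (simp add: ratio_root_def flip: of_real_mult real_sqrt_mult)

text \<open>
  This is the numerator of the scalar weight before it is raised to the power \<open>L div 2\<close>.
\<close>

definition eigenvalue :: "real \<Rightarrow> real \<Rightarrow> complex \<Rightarrow> complex" where
  "eigenvalue \<alpha>1 \<alpha>2 \<zeta> =
     (\<zeta> - of_real (eta \<alpha>1 \<alpha>2 \<alpha>1)) * (\<zeta> - of_real (eta \<alpha>1 \<alpha>2 \<alpha>2))"

text \<open>
  This is half the trace of \<open>W \<alpha>1 z ** W \<alpha>2 z\<close> plus a square root of a quarter of the discriminant,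
  at \<open>z = \<zeta>\<^sup>2 - \<beta>\<^sup>2\<close>.
\<close>

lemma eigenvalue_expand:
  assumes "\<alpha>1 > 0" "\<alpha>2 > 0"
  shows "eigenvalue \<alpha>1 \<alpha>2 \<zeta> = \<zeta>\<^sup>2 - (of_real (beta \<alpha>1 \<alpha>2))\<^sup>2
    + of_real (sqrt (1 + \<alpha>1) * sqrt (1 + \<alpha>2)) * \<zeta> + of_real ((1 + \<alpha>1 * \<alpha>2) / 2)"
proof -
  define x y where "x = sqrt (1 + \<alpha>1)" and "y = sqrt (1 + \<alpha>2)"
  have xy: "x > 0" "y > 0" "\<alpha>1 = x\<^sup>2 - 1" "\<alpha>2 = y\<^sup>2 - 1"
    using assms by (simp_all add: x_def y_def)
  \<comment> \<open>In terms of \<open>x\<close> and \<open>y\<close> the sum and the product of the two zeros are rational functions.\<close>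
  have sum: "eta \<alpha>1 \<alpha>2 \<alpha>1 + eta \<alpha>1 \<alpha>2 \<alpha>2 = - (x * y)"
    using xy(1,2) unfolding eta_def x_def[symmetric] y_def[symmetric]
    by (simp add: xy(3,4) field_simps power2_eq_square)
  have prod: "eta \<alpha>1 \<alpha>2 \<alpha>1 * eta \<alpha>1 \<alpha>2 \<alpha>2 = (1 + \<alpha>1 * \<alpha>2) / 2 - (beta \<alpha>1 \<alpha>2)\<^sup>2"
    using xy(1,2) unfolding eta_def beta_def x_def[symmetric] y_def[symmetric]
    by (simp add: xy(3,4) field_simps power2_eq_square)
  have "eigenvalue \<alpha>1 \<alpha>2 \<zeta> = \<zeta>\<^sup>2 - of_real (eta \<alpha>1 \<alpha>2 \<alpha>1 + eta \<alpha>1 \<alpha>2 \<alpha>2) * \<zeta>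
      + of_real (eta \<alpha>1 \<alpha>2 \<alpha>1 * eta \<alpha>1 \<alpha>2 \<alpha>2)"
    by (simp add: eigenvalue_def algebra_simps power2_eq_square)
  then show ?thesis
    unfolding sum prod x_def y_def by (simp add: algebra_simps)
qed

lemma W_product_eigenvector:
  fixes \<alpha>1 \<alpha>2 :: real and \<zeta> :: complex
  defines "\<beta> \<equiv> complex_of_real (beta \<alpha>1 \<alpha>2)" and "s \<equiv> ratio_root \<alpha>1 \<alpha>2"
  defines "v \<equiv> (vector [s, \<zeta> + \<beta>] :: complex^2)"
  assumes pos: "\<alpha>1 > 0" "\<alpha>2 > 0"
  shows "(W \<alpha>1 (\<zeta>\<^sup>2 - \<beta>\<^sup>2) ** W \<alpha>2 (\<zeta>\<^sup>2 - \<beta>\<^sup>2)) *v v = eigenvalue \<alpha>1 \<alpha>2 \<zeta> *s v"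
proof -
  define x y where "x = sqrt (1 + \<alpha>1)" and "y = sqrt (1 + \<alpha>2)"
  define X Y where "X = complex_of_real x" and "Y = complex_of_real y"
  have xy: "x > 0" "y > 0" "\<alpha>1 = x\<^sup>2 - 1" "\<alpha>2 = y\<^sup>2 - 1"
    using pos by (simp_all add: x_def y_def)
  have "beta \<alpha>1 \<alpha>2 * (x * y) = (1 - \<alpha>1 * \<alpha>2) / 2"
    using xy(1,2) by (simp add: beta_def x_def y_def)
  then have "complex_of_real (beta \<alpha>1 \<alpha>2 * (x * y)) = of_real ((1 - \<alpha>1 * \<alpha>2) / 2)"
    by (rule arg_cong)
  then have \<beta>XY: "\<beta> * (X * Y) = (1 - of_real \<alpha>1 * of_real \<alpha>2) / 2"
    by (simp add: \<beta>_def X_def Y_def)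
  have sY: "s * Y = X"
    using xy(1,2) by (simp add: s_def ratio_root_def X_def Y_def x_def y_def real_sqrt_divide)
  have XX: "X * X = 1 + of_real \<alpha>1" and YY: "Y * Y = 1 + of_real \<alpha>2"
    by (simp_all add: X_def Y_def xy(3,4) power2_eq_square)
  have ev: "eigenvalue \<alpha>1 \<alpha>2 \<zeta> = \<zeta>\<^sup>2 - \<beta>\<^sup>2 + X * Y * \<zeta> + (1 + of_real \<alpha>1 * of_real \<alpha>2) / 2"
    by (simp add: eigenvalue_expand[OF pos] \<beta>_def X_def Y_def x_def y_def)
  \<comment> \<open>The rows of the eigenvector equation are polynomial consequences of these four relations.\<close>
  have "(of_real \<alpha>1 * of_real \<alpha>2 + (\<zeta>\<^sup>2 - \<beta>\<^sup>2)) * s + (of_real \<alpha>1 + 1) * (\<zeta> + \<beta>)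
      = eigenvalue \<alpha>1 \<alpha>2 \<zeta> * s"
    using \<beta>XY sY XX unfolding ev by algebra
  moreover have "(of_real \<alpha>2 + 1) * (\<zeta>\<^sup>2 - \<beta>\<^sup>2) * s + (\<zeta>\<^sup>2 - \<beta>\<^sup>2 + 1) * (\<zeta> + \<beta>)
      = eigenvalue \<alpha>1 \<alpha>2 \<zeta> * (\<zeta> + \<beta>)"
    using \<beta>XY sY YY unfolding ev by algebra
  ultimately show ?thesis
    by (simp add: W_def mat2_mult vec_eq_iff forall_2 matrix_vector_mult_def sum_2 v_def algebra_simps)
qed

lemma mat_power_eigenvector:
  assumes "A *v v = c *s v"
  shows "mat_power A n *v v = (c ^ n) *s v"
proof (induction n)
  case (Suc n)
  have "mat_power A (Suc n) *v v = A *v (mat_power A n *v v)"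
    by (simp add: matrix_vector_mul_assoc)
  also have "\<dots> = c ^ n *s (A *v v)"
    by (simp only: Suc) (simp add: matrix_vector_mult_def vec_eq_iff sum_2 algebra_simps)
  finally show ?case
    by (simp add: assms vec_eq_iff)
qed simp

section \<open>From rows of matrices to scalar polynomials\<close>

text \<open>
  The product of the row \<open>(f, g)\<close>, taken at \<open>z = \<zeta>\<^sup>2 - b\<^sup>2\<close>, with the column \<open>(s, \<zeta> + b)\<close>, sorted into its even
  and odd part.
\<close>

definition row_poly :: "complex \<Rightarrow> complex \<Rightarrow> complex poly \<Rightarrow> complex poly \<Rightarrow> complex poly" where
  "row_poly b s f g = even_odd_poly b (smult s f + smult b g) g"

lemma poly_row_poly:
  "poly (row_poly b s f g) \<zeta> = s * poly f (\<zeta>\<^sup>2 - b\<^sup>2) + (\<zeta> + b) * poly g (\<zeta>\<^sup>2 - b\<^sup>2)"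
  by (simp add: row_poly_def poly_even_odd_poly algebra_simps)

lemma row_poly_coeffs:
  assumes "degree f \<le> k" "degree g \<le> k"
  shows "degree (row_poly b s f g) \<le> 2 * k + 1"
    and "coeff (row_poly b s f g) (2 * k + 1) = coeff g k"
    and "coeff (row_poly b s f g) (2 * k) = s * coeff f k + b * coeff g k"
proof -
  have "degree (smult s f + smult b g) \<le> k"
    using assms by (intro degree_add_le order.trans[OF degree_smult_le])
  from even_odd_poly_coeffs[OF this assms(2), of b]
  show "degree (row_poly b s f g) \<le> 2 * k + 1"
    "coeff (row_poly b s f g) (2 * k + 1) = coeff g k"
    "coeff (row_poly b s f g) (2 * k) = s * coeff f k + b * coeff g k"
    by (simp_all add: row_poly_def)
qed

text \<open>
  Since \<open>(s, \<zeta> + \<beta>)\<close> is an eigenvector, the scalar weight times the polynomial of a row of \<open>M\<close> is the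
  polynomial of the same row of \<open>M ** N\<close> over \<open>(\<zeta>\<^sup>2 - \<beta>\<^sup>2)\<^sup>K\<close>.
\<close>

lemma scalar_orth_row_poly_iff:
  fixes \<alpha>1 \<alpha>2 :: real
    and M N :: "complex poly^2^2"
  defines "\<beta> \<equiv> complex_of_real (beta \<alpha>1 \<alpha>2)" and "s \<equiv> ratio_root \<alpha>1 \<alpha>2"
  assumes pos: "\<alpha>1 > 0" "\<alpha>2 > 0" and R: "R > \<bar>beta \<alpha>1 \<alpha>2\<bar>" and k: "k \<le> K"
    and N: "\<And>z. mat_power (W \<alpha>1 z ** W \<alpha>2 z) (L div 2) = eval_mat N z"
  shows "scalar_orth K L k \<alpha>1 \<alpha>2 R (row_poly \<beta> s (M $ i $ 1) (M $ i $ 2)) \<longleftrightarrow>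
    (\<forall>l. window_zero K k ((M ** N) $ i $ l))"
proof -
  define n where "n = L div 2"
  let ?A = "(M ** N) $ i $ 1" and ?B = "(M ** N) $ i $ 2"
  have s: "s \<noteq> 0"
    using ratio_root_swap[OF pos] by (auto simp: s_def)
  have key: "poly (row_poly \<beta> s (M $ i $ 1) (M $ i $ 2)) \<zeta> * eigenvalue \<alpha>1 \<alpha>2 \<zeta> ^ n
      = poly (row_poly \<beta> s ?A ?B) \<zeta>" for \<zeta>
  proof -
    define z where "z = \<zeta>\<^sup>2 - \<beta>\<^sup>2"
    define v where "v = (vector [s, \<zeta> + \<beta>] :: complex^2)"
    have "eval_mat N z *v v = (eigenvalue \<alpha>1 \<alpha>2 \<zeta> ^ n) *s v"
      using mat_power_eigenvector[OF W_product_eigenvector[OF pos, of \<zeta>], of n] N[of z]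
      by (simp add: v_def z_def \<beta>_def s_def n_def)
    then have "(eval_mat M z *v ((eigenvalue \<alpha>1 \<alpha>2 \<zeta> ^ n) *s v)) $ i = (eval_mat (M ** N) z *v v) $ i"
      by (simp add: eval_mat_mult matrix_vector_mul_assoc[symmetric])
    then show ?thesis
      by (simp add: poly_row_poly v_def matrix_vector_mult_def sum_2 eval_mat_def z_def algebra_simps)
  qed
  have "poly (row_poly \<beta> s (M $ i $ 1) (M $ i $ 2)) \<zeta> * \<zeta> ^ j * scalar_weight K L \<alpha>1 \<alpha>2 \<zeta>
      = poly (row_poly \<beta> s ?A ?B) \<zeta> * \<zeta> ^ j / (\<zeta>\<^sup>2 - \<beta>\<^sup>2) ^ K" for \<zeta> and j :: nat
    by (simp only: key[symmetric]) (simp add: scalar_weight_def n_def \<beta>_def eigenvalue_def)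
  then have "scalar_orth K L k \<alpha>1 \<alpha>2 R (row_poly \<beta> s (M $ i $ 1) (M $ i $ 2)) \<longleftrightarrow>
      window_zero K k (smult s ?A + smult \<beta> ?B) \<and> window_zero K k ?B"
    using orthogonal_even_odd_poly_iff[of \<beta> R k K "smult s ?A + smult \<beta> ?B" ?B] R k
    by (simp add: scalar_orth_def row_poly_def \<beta>_def)
  also have "\<dots> \<longleftrightarrow> window_zero K k ?A \<and> window_zero K k ?B"
    using s by (auto simp: window_zero_def)
  finally show ?thesis by (simp add: forall_2)
qed

lemma scalar_orth_linear:
  assumes R: "R > \<bar>beta \<alpha>1 \<alpha>2\<bar>"
    and "scalar_orth K L k \<alpha>1 \<alpha>2 R p" "scalar_orth K L k \<alpha>1 \<alpha>2 R q"
  shows "scalar_orth K L k \<alpha>1 \<alpha>2 R (smult c p + smult d q)"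
proof -
  let ?F = "\<lambda>q j \<zeta>. poly q \<zeta> * \<zeta> ^ j * scalar_weight K L \<alpha>1 \<alpha>2 \<zeta>"
  have int: "?F q j contour_integrable_on circlepath 0 R" for q j
    unfolding scalar_weight_def times_divide_eq_right
    by (intro contour_integrable_over_quadratic continuous_intros) (use R in simp)
  have "contour_integral (circlepath 0 R) (?F (smult c p + smult d q) j) =
      c * contour_integral (circlepath 0 R) (?F p j) + d * contour_integral (circlepath 0 R) (?F q j)" for j
  proof -
    have "?F (smult c p + smult d q) j = (\<lambda>\<zeta>. c * ?F p j \<zeta> + d * ?F q j \<zeta>)"
      by (simp add: fun_eq_iff algebra_simps)
    then show ?thesis
      by (simp only:) (simp add: contour_integral_add contour_integral_lmul contour_integrable_lmul int)
  qed
  with assms(2,3) show ?thesis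
    by (simp add: scalar_orth_def)
qed

section \<open>The correspondence between matrix and scalar orthogonality\<close>

lemma monic_polyI: "degree q \<le> n \<Longrightarrow> coeff q n = 1 \<Longrightarrow> monic_poly n q"
  unfolding monic_poly_def by (metis le_antisym le_degree zero_neq_one)

theorem theorem1p4:
  fixes K L k :: nat and \<alpha>1 \<alpha>2 R :: real
    and \<gamma> :: "real \<Rightarrow> complex" and P :: "complex \<Rightarrow> complex^2^2"
  assumes "2 * int K - int L \<le> 2 * int k" and "2 * int k \<le> 2 * int K"
    and "even L"
    and "\<alpha>1 > 0" and "\<alpha>2 > 0"
    and "goes_once_around_0 \<gamma>"
    and "R > \<bar>beta \<alpha>1 \<alpha>2\<bar>"
    and "is_mvop K L k \<alpha>1 \<alpha>2 \<gamma> P"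
    and unique: "\<And>Q. is_mvop K L k \<alpha>1 \<alpha>2 \<gamma> Q \<Longrightarrow> Q = P"
  shows
    "(\<exists>q0 q1 :: complex poly.
        monic_poly (2 * k) q0 \<and> monic_poly (2 * k + 1) q1 \<and>
        (\<forall>\<zeta>. let \<beta> = complex_of_real (beta \<alpha>1 \<alpha>2);
                  s = complex_of_real (sqrt ((1 + \<alpha>1) / (1 + \<alpha>2)));
                  t = complex_of_real (sqrt ((1 + \<alpha>2) / (1 + \<alpha>1)))
          in mat2 t 0 0 1 ** P (\<zeta>\<^sup>2 - \<beta>\<^sup>2) ** mat2 s s (\<zeta> + \<beta>) (- \<zeta> + \<beta>)
             = mat2 (poly q0 \<zeta>) (poly q0 (- \<zeta>)) (poly q1 \<zeta>) (poly q1 (- \<zeta>))) \<and>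
        scalar_orth K L k \<alpha>1 \<alpha>2 R q0 \<and> scalar_orth K L k \<alpha>1 \<alpha>2 R q1)
     \<and>
     (\<forall>q0 q1 :: complex poly.
        monic_poly (2 * k) q0 \<longrightarrow> monic_poly (2 * k + 1) q1 \<longrightarrow>
        scalar_orth K L k \<alpha>1 \<alpha>2 R q0 \<longrightarrow> scalar_orth K L k \<alpha>1 \<alpha>2 R q1 \<longrightarrow>
        (\<forall>z. z + (complex_of_real (beta \<alpha>1 \<alpha>2))\<^sup>2 \<notin> \<real>\<^sub>\<le>\<^sub>0 \<longrightarrow>
          (let \<beta> = complex_of_real (beta \<alpha>1 \<alpha>2);
               s = complex_of_real (sqrt ((1 + \<alpha>1) / (1 + \<alpha>2)));
               t = complex_of_real (sqrt ((1 + \<alpha>2) / (1 + \<alpha>1)));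
               c = \<beta> - 1 / (2 * of_real pi * \<i>) *
                         contour_integral \<gamma> (\<lambda>\<zeta>. poly q1 \<zeta> / \<zeta> ^ (2 * k + 1));
               \<zeta> = csqrt (z + \<beta>\<^sup>2)
           in P z = mat2 s 0 0 1 ** mat2 1 0 c 1
                    ** mat2 (poly q0 \<zeta>) (poly q0 (- \<zeta>)) (poly q1 \<zeta>) (poly q1 (- \<zeta>))
                    ** matrix_inv (mat2 s s (\<zeta> + \<beta>) (- \<zeta> + \<beta>))
            \<and> P z = mat2 s 0 0 1 ** mat2 1 0 c 1
                    ** mat2 ((poly q0 \<zeta> + poly q0 (- \<zeta>)) / 2)
                            ((poly q0 \<zeta> - poly q0 (- \<zeta>)) / (2 * \<zeta>))
                            ((poly q1 \<zeta> + poly q1 (- \<zeta>)) / 2)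
                            ((poly q1 \<zeta> - poly q1 (- \<zeta>)) / (2 * \<zeta>))
                    ** mat2 1 0 (- \<beta>) 1 ** mat2 t 0 0 1)))"
proof -
  define \<beta> where "\<beta> = complex_of_real (beta \<alpha>1 \<alpha>2)"
  define s where "s = ratio_root \<alpha>1 \<alpha>2"
  define t where "t = ratio_root \<alpha>2 \<alpha>1"
  note pos = \<open>\<alpha>1 > 0\<close> \<open>\<alpha>2 > 0\<close> and R = \<open>R > \<bar>beta \<alpha>1 \<alpha>2\<bar>\<close> and \<gamma> = \<open>goes_once_around_0 \<gamma>\<close>
  have "k \<le> K"
    using \<open>2 * int k \<le> 2 * int K\<close> by simp
  have st: "s * t = 1" "s \<noteq> 0" "t \<noteq> 0"
    using ratio_root_swap[OF pos] by (auto simp: s_def t_def)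
  obtain N where N: "mat_power (W \<alpha>1 z ** W \<alpha>2 z) (L div 2) = eval_mat N z" for z
    using W_product_power_polynomial by blast
  note mvop_iff = is_mvop_eval_mat_iff[OF \<gamma> \<open>k \<le> K\<close> N]
  note row_iff = scalar_orth_row_poly_iff[OF pos R \<open>k \<le> K\<close> N, folded \<beta>_def s_def]
  define E where "E \<zeta> = mat2 s s (\<zeta> + \<beta>) (- \<zeta> + \<beta>)" for \<zeta>
  have part_a: "\<exists>q0 q1. monic_poly (2 * k) q0 \<and> monic_poly (2 * k + 1) q1 \<and>
      (\<forall>\<zeta>. mat2 t 0 0 1 ** P (\<zeta>\<^sup>2 - \<beta>\<^sup>2) ** E \<zeta> =
         mat2 (poly q0 \<zeta>) (poly q0 (- \<zeta>)) (poly q1 \<zeta>) (poly q1 (- \<zeta>))) \<and>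
      scalar_orth K L k \<alpha>1 \<alpha>2 R q0 \<and> scalar_orth K L k \<alpha>1 \<alpha>2 R q1"
  proof -
    obtain M where M: "P = eval_mat M" "\<And>i j. degree (M $ i $ j) \<le> k"
      "\<And>i j. coeff (M $ i $ j) k = (if i = j then 1 else 0)"
      using \<open>is_mvop K L k \<alpha>1 \<alpha>2 \<gamma> P\<close> monic_matrix_poly_eval_mat_iff by (auto simp: is_mvop_def)
    define r where "r i = row_poly \<beta> s (M $ i $ 1) (M $ i $ 2)" for i
    have r: "degree (r i) \<le> 2 * k + 1" "coeff (r i) (2 * k + 1) = coeff (M $ i $ 2) k"
      "coeff (r i) (2 * k) = s * coeff (M $ i $ 1) k + \<beta> * coeff (M $ i $ 2) k" for i
      unfolding r_def using M(2) by (intro row_poly_coeffs; simp)+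
    have orth: "scalar_orth K L k \<alpha>1 \<alpha>2 R (r i)" for i
      using \<open>is_mvop K L k \<alpha>1 \<alpha>2 \<gamma> P\<close> row_iff by (auto simp: r_def M(1) mvop_iff)
    \<comment> \<open>The upper right entry has degree less than \<open>k\<close>, which removes the term of degree \<open>2k + 1\<close>.\<close>
    have "degree (r 1) \<le> 2 * k"
    proof (rule ccontr)
      assume "\<not> degree (r 1) \<le> 2 * k"
      then have "degree (r 1) = 2 * k + 1"
        using r(1)[of 1] by simp
      moreover have "coeff (r 1) (2 * k + 1) = 0"
        using r(2) M(3) by simp
      ultimately show False
        by (metis add_is_0 degree_0 leading_coeff_0_iff one_neq_zero)
    qed
    then have "monic_poly (2 * k) (smult t (r 1))"
      using r(3)[of 1] M(3) st(1) by (intro monic_polyI) (simp_all add: st(3) mult.commute)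
    moreover have "monic_poly (2 * k + 1) (r 2)"
      using r(1,2)[of 2] M(3) by (intro monic_polyI) simp_all
    moreover have "scalar_orth K L k \<alpha>1 \<alpha>2 R (smult t (r 1))"
      using scalar_orth_linear[OF R orth orth, of t 1 0 1] by simp
    moreover have "mat2 t 0 0 1 ** P (\<zeta>\<^sup>2 - \<beta>\<^sup>2) ** E \<zeta> =
        mat2 (poly (smult t (r 1)) \<zeta>) (poly (smult t (r 1)) (- \<zeta>)) (poly (r 2) \<zeta>) (poly (r 2) (- \<zeta>))"
      for \<zeta>
      by (simp add: mat2_eq_iff matrix_mult_2 E_def M(1) eval_mat_def r_def poly_row_poly algebra_simps)
    ultimately show ?thesis
      using orth[of 2] by blast
  qed
  have part_b: "P z = mat2 s 0 0 1 ** mat2 1 0 c 1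
        ** mat2 (poly q0 \<zeta>) (poly q0 (- \<zeta>)) (poly q1 \<zeta>) (poly q1 (- \<zeta>)) ** matrix_inv (E \<zeta>) \<and>
      P z = mat2 s 0 0 1 ** mat2 1 0 c 1
        ** mat2 ((poly q0 \<zeta> + poly q0 (- \<zeta>)) / 2) ((poly q0 \<zeta> - poly q0 (- \<zeta>)) / (2 * \<zeta>))
             ((poly q1 \<zeta> + poly q1 (- \<zeta>)) / 2) ((poly q1 \<zeta> - poly q1 (- \<zeta>)) / (2 * \<zeta>))
        ** mat2 1 0 (- \<beta>) 1 ** mat2 t 0 0 1"
    if q: "monic_poly (2 * k) q0" "monic_poly (2 * k + 1) q1"
      "scalar_orth K L k \<alpha>1 \<alpha>2 R q0" "scalar_orth K L k \<alpha>1 \<alpha>2 R q1"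
      and z: "z + \<beta>\<^sup>2 \<notin> \<real>\<^sub>\<le>\<^sub>0"
      and c: "c = \<beta> - 1 / (2 * of_real pi * \<i>) * contour_integral \<gamma> (\<lambda>\<zeta>. poly q1 \<zeta> / \<zeta> ^ (2 * k + 1))"
      and \<zeta>: "\<zeta> = csqrt (z + \<beta>\<^sup>2)"
    for q0 q1 z c \<zeta>
  proof -
    have deg: "degree q0 \<le> 2 * k + 1" "degree q1 \<le> 2 * k + 1"
      and lead: "coeff q0 (2 * k) = 1" "coeff q0 (2 * k + 1) = 0" "coeff q1 (2 * k + 1) = 1"
      using q(1,2) by (auto simp: monic_poly_def coeff_eq_0)
    obtain a0 b0 where q0: "q0 = even_odd_poly \<beta> a0 b0" and ab0: "degree a0 \<le> k" "degree b0 \<le> k"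
      using even_odd_poly_exists[OF deg(1)] by blast
    obtain a1 b1 where q1: "q1 = even_odd_poly \<beta> a1 b1" and ab1: "degree a1 \<le> k" "degree b1 \<le> k"
      using even_odd_poly_exists[OF deg(2)] by blast
    have top: "coeff a0 k = 1" "coeff b0 k = 0" "coeff b1 k = 1" "coeff a1 k = coeff q1 (2 * k)"
      using even_odd_poly_coeffs[OF ab0, of \<beta>] even_odd_poly_coeffs[OF ab1, of \<beta>] lead by (simp_all add: q0 q1)
    \<comment> \<open>The integral in \<open>c\<close> is the coefficient of degree \<open>2k\<close> of \<open>q1\<close>.\<close>
    have c': "c = \<beta> - coeff a1 k"
      using contour_integral_poly_over_power[OF \<gamma>, of q1 "2 * k"] by (simp add: c top)
    \<comment> \<open>The rows whose polynomials are \<open>s q0\<close> and \<open>q1 + c q0\<close>, solved for their entries with \<open>t = 1 / s\<close>.\<close>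
    define M :: "complex poly^2^2" where
      "M = vector [vector [a0 - smult \<beta> b0, smult s b0],
        vector [smult t (a1 + smult c a0 - smult \<beta> (b1 + smult c b0)), b1 + smult c b0]]"
    have M_nth: "M $ 1 $ 1 = a0 - smult \<beta> b0" "M $ 1 $ 2 = smult s b0"
      "M $ 2 $ 1 = smult t (a1 + smult c a0 - smult \<beta> (b1 + smult c b0))"
      "M $ 2 $ 2 = b1 + smult c b0"
      by (simp_all add: M_def)
    have "\<forall>i j. degree (M $ i $ j) \<le> k"
      using ab0 ab1 by (auto simp: forall_2 M_nth st
          intro!: degree_add_le degree_diff_le order.trans[OF degree_smult_le])
    moreover have "\<forall>i j. coeff (M $ i $ j) k = (if i = j then 1 else 0)"
      by (simp add: forall_2 M_nth top c' algebra_simps)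
    ultimately have "monic_matrix_poly k (eval_mat M)"
      using monic_matrix_poly_eval_mat_iff by blast
    moreover have "row_poly \<beta> s (M $ 1 $ 1) (M $ 1 $ 2) = smult s q0"
      by (simp add: row_poly_def M_nth q0 smult_even_odd_poly algebra_simps smult_add_right smult_diff_right)
    then have "scalar_orth K L k \<alpha>1 \<alpha>2 R (row_poly \<beta> s (M $ 1 $ 1) (M $ 1 $ 2))"
      using scalar_orth_linear[OF R q(3) q(3), of s 0] by simp
    then have "window_zero K k ((M ** N) $ 1 $ l)" for l
      using row_iff by blast
    moreover have "row_poly \<beta> s (M $ 2 $ 1) (M $ 2 $ 2) = smult 1 q1 + smult c q0"
      by (simp add: row_poly_def M_nth q0 q1 smult_even_odd_poly even_odd_poly_add st)
    then have "scalar_orth K L k \<alpha>1 \<alpha>2 R (row_poly \<beta> s (M $ 2 $ 1) (M $ 2 $ 2))"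
      using scalar_orth_linear[OF R q(4,3)] by metis
    then have "window_zero K k ((M ** N) $ 2 $ l)" for l
      using row_iff by blast
    ultimately have "is_mvop K L k \<alpha>1 \<alpha>2 \<gamma> (eval_mat M)"
      by (simp add: mvop_iff forall_2)
    then have P: "P = eval_mat M"
      using unique by blast
    have z_eq: "z = \<zeta>\<^sup>2 - \<beta>\<^sup>2" and "\<zeta> \<noteq> 0"
      using z by (auto simp: \<zeta>)
    have halves: "(poly q \<zeta> + poly q (- \<zeta>)) / 2 = poly a z"
        "(poly q \<zeta> - poly q (- \<zeta>)) / (2 * \<zeta>) = poly b z" if "q = even_odd_poly \<beta> a b" for q a b
      using \<open>\<zeta> \<noteq> 0\<close> by (simp_all add: that poly_even_odd_poly z_eq)
    let ?H = "mat2 (poly a0 z) (poly b0 z) (poly a1 z) (poly b1 z)"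
    let ?G = "?H ** mat2 1 0 (- \<beta>) 1 ** mat2 t 0 0 1"
    have cancel: "s * (t * x) = x" for x
      using st(1) by (simp flip: mult.assoc)
    have second: "P z = mat2 s 0 0 1 ** mat2 1 0 c 1 ** ?G"
      by (simp add: mat2_eq_iff matrix_mult_2 P eval_mat_def M_nth cancel algebra_simps)
    \<comment> \<open>The first formula follows from the second because \<open>E \<zeta>\<close> is invertible for \<open>\<zeta> \<noteq> 0\<close>.\<close>
    let ?Q = "mat2 (poly q0 \<zeta>) (poly q0 (- \<zeta>)) (poly q1 \<zeta>) (poly q1 (- \<zeta>))"
    have "det (E \<zeta>) = - 2 * s * \<zeta>"
      by (simp add: det_2 E_def algebra_simps)
    then have "invertible (E \<zeta>)"
      using \<open>\<zeta> \<noteq> 0\<close> st by (simp add: invertible_det_nz)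
    then have E_inverse: "E \<zeta> ** matrix_inv (E \<zeta>) = mat 1"
      unfolding matrix_inv_def invertible_def by (rule someI2_ex) simp
    have "?Q = ?G ** E \<zeta>"
      using st(1)
      by (simp add: mat2_eq_iff matrix_mult_2 E_def q0 q1 poly_even_odd_poly flip: z_eq) algebra
    then have "?Q ** matrix_inv (E \<zeta>) = ?G"
      by (simp only: matrix_mul_assoc[symmetric] E_inverse matrix_mul_rid)
    then have first: "P z = mat2 s 0 0 1 ** mat2 1 0 c 1 ** ?Q ** matrix_inv (E \<zeta>)"
      using second by (simp only: matrix_mul_assoc[symmetric])
    show ?thesis
      using first second unfolding halves[OF q0] halves[OF q1]
      by (simp only: matrix_mul_assoc)
  qed
  show ?thesis
    using part_a part_b
    unfolding Let_def E_def \<beta>_def s_def t_def ratio_root_def by blast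
qed

end
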